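(* Let $\widetilde{G}$ be a $U(\mathbb{Q})$-gain graph of order $n$ in which every connected component has at least two vertices. Then (i) if $p(\widetilde{G})\geq 1$, then $r(\widetilde{G})\geq n-2c(\widetilde{G})-p(\widetilde{G})+1$; (ii) if $p(\widetilde{G})=0$ and $\widetilde{G}$ is cycle-disjoint (any two distinct cycles of $\widetilde{G}$ have no common vertex), then $r(\widetilde{G})\geq n-2c(\widetilde{G})$; (iii) if $p(\widetilde{G})=0$ and some two distinct cycles of $\widetilde{G}$ have a common vertex, then $r(\widetilde{G})\geq n-2c(\widetilde{G})+1$.
   Context: All graphs are finite and simple (no loops or multiple edges). $\mathbb{Q}$ denotes the real quaternions (not the rationals), and $U(\mathbb{Q})=\{q\in\mathbb{Q}:|q|=1\}$. A $U(\mathbb{Q})$-gain graph $\widetilde{G}=(G,U(\mathbb{Q}),\varphi)$ consists of a simple graph $G$ with vertices $v_1,\dots,v_n$ (the underlying graph) and a map $\varphi$ assigning to each ordered pair $(v_i,v_j)$ of adjacent vertices a unit quaternion $\varphi_{v_iv_j}$ with $\varphi_{v_iv_j}=\varphi_{v_jv_i}^{-1}=\overline{\varphi_{v_jv_i}}$. Its adjacency matrix $A(\widetilde{G})=(h_{ij})$ is the $n\times n$ Hermitian quaternion matrix with $h_{ij}=\varphi_{v_iv_j}$ if $v_i,v_j$ are adjacent and $h_{ij}=0$ otherwise. The rank $r(\widetilde{G})$ is the row left rank of $A(\widetilde{G})$, i.e. the maximum number of rows that are left linearly independent over $\mathbb{Q}$. $p(\widetilde{G})$ is the number of pendant vertices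 (vertices of degree 1), and $c(\widetilde{G})=|E(\widetilde{G})|-|V(\widetilde{G})|+\omega(\widetilde{G})$ is the cyclomatic number, where $\omega(\widetilde{G})$ is the number of connected components. Graph-theoretic notions (cycles, components, degrees) refer to the underlying graph. *)

theory Defs
  imports "HOL-Analysis.Analysis" "Graph_Theory.Graph_Theory"
begin

section \<open>The real quaternions\<close>

datatype quat = Quat (qRe: real) (qI: real) (qJ: real) (qK: real)

lemma quat_eq_iff: "p = q \<longleftrightarrow> qRe p = qRe q \<and> qI p = qI q \<and> qJ p = qJ q \<and> qK p = qK q"
  by (auto intro: quat.expand)

instantiation quat :: real_normed_div_algebra
begin

definition "0 = Quat 0 0 0 0"
definition "1 = Quat 1 0 0 0"
definition "p + q = Quat (qRe p + qRe q) (qI p + qI q) (qJ p + qJ q) (qK p + qK q)"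
definition "- p = Quat (- qRe p) (- qI p) (- qJ p) (- qK p)"
definition "p - q = Quat (qRe p - qRe q) (qI p - qI q) (qJ p - qJ q) (qK p - qK q)"
definition "p * q = Quat
  (qRe p * qRe q - qI p * qI q - qJ p * qJ q - qK p * qK q)
  (qRe p * qI q + qI p * qRe q + qJ p * qK q - qK p * qJ q)
  (qRe p * qJ q - qI p * qK q + qJ p * qRe q + qK p * qI q)
  (qRe p * qK q + qI p * qJ q - qJ p * qI q + qK p * qRe q)"
definition "r *\<^sub>R q = Quat (r * qRe q) (r * qI q) (r * qJ q) (r * qK q)"
definition "norm q = sqrt ((qRe q)\<^sup>2 + (qI q)\<^sup>2 + (qJ q)\<^sup>2 + (qK q)\<^sup>2)"
definition "inverse q =
  inverse ((norm q)\<^sup>2) *\<^sub>R Quat (qRe q) (- qI q) (- qJ q) (- qK q)" for q :: quat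
definition "p div q = p * inverse q" for p q :: quat
definition "sgn q = inverse (norm q) *\<^sub>R q" for q :: quat
definition "dist p q = norm (p - q)" for p q :: quat
definition "(uniformity :: (quat \<times> quat) filter) = (INF e\<in>{0<..}. principal {(x, y). dist x y < e})"
definition "open (U :: quat set) \<longleftrightarrow> (\<forall>x\<in>U. eventually (\<lambda>(x', y). x' = x \<longrightarrow> y \<in> U) uniformity)"

lemmas quat_ops = zero_quat_def one_quat_def plus_quat_def uminus_quat_def minus_quat_def
  times_quat_def scaleR_quat_def

lemma norm_quat_prod:
  "norm (q :: quat) = norm ((qRe q, qI q), (qJ q, qK q))"
  by (simp add: norm_quat_def norm_prod_def)

lemma norm_quat_sq: "(norm q)\<^sup>2 = (qRe q)\<^sup>2 + (qI q)\<^sup>2 + (qJ q)\<^sup>2 + (qK q)\<^sup>2"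
  for q :: quat
  by (simp add: norm_quat_def)

lemma norm_quat_eq_0_iff: "norm q = 0 \<longleftrightarrow> q = 0" for q :: quat
  by (simp add: norm_quat_prod zero_prod_def quat_eq_iff zero_quat_def)

lemma norm_quat_mult: "norm (p * q) = norm p * norm q" for p q :: quat
  unfolding norm_quat_def real_sqrt_mult[symmetric]
  by (rule arg_cong[of _ _ sqrt]) (simp add: times_quat_def power2_eq_square algebra_simps)

lemma quat_inverse_laws:
  fixes q :: quat
  assumes "q \<noteq> 0"
  shows "inverse q * q = 1" "q * inverse q = 1"
proof -
  have "(norm q)\<^sup>2 \<noteq> 0" using assms by (simp add: norm_quat_eq_0_iff)
  then have nz: "(qRe q)\<^sup>2 + (qI q)\<^sup>2 + (qJ q)\<^sup>2 + (qK q)\<^sup>2 \<noteq> 0"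
    by (simp only: norm_quat_sq not_False_eq_True)
  show "inverse q * q = 1" "q * inverse q = 1"
    unfolding inverse_quat_def norm_quat_sq using nz
    by (simp_all add: quat_ops divide_inverse[symmetric] divide_simps)
       (simp_all add: power2_eq_square algebra_simps)
qed

instance
proof
  fix p q r :: quat and a b :: real
  show "norm (p + q) \<le> norm p + norm q"
    using norm_triangle_ineq[of "((qRe p, qI p), (qJ p, qK p))" "((qRe q, qI q), (qJ q, qK q))"]
    by (simp add: norm_quat_prod plus_quat_def)
  show "norm (a *\<^sub>R q) = \<bar>a\<bar> * norm q"
    using norm_scaleR[of a "((qRe q, qI q), (qJ q, qK q))"]
    by (simp add: norm_quat_prod scaleR_quat_def)
  show "(norm q = 0) = (q = 0)" by (rule norm_quat_eq_0_iff)
  show "norm (p * q) = norm p * norm q" by (rule norm_quat_mult)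
  show "q \<noteq> 0 \<Longrightarrow> inverse q * q = 1" "q \<noteq> 0 \<Longrightarrow> q * inverse q = 1"
    by (simp_all add: quat_inverse_laws)
  show "inverse (0 :: quat) = 0"
    by (simp add: inverse_quat_def quat_ops)
  show "dist p q = norm (p - q)" by (rule dist_quat_def)
  show "sgn q = inverse (norm q) *\<^sub>R q" by (rule sgn_quat_def)
  show "p div q = p * inverse q" by (rule divide_quat_def)
  show "uniformity = (INF e\<in>{0<..}. principal {(x :: quat, y). dist x y < e})"
    by (rule uniformity_quat_def)
  show "open U \<longleftrightarrow> (\<forall>x\<in>U. eventually (\<lambda>(x', y). x' = x \<longrightarrow> y \<in> U) uniformity)" for U :: "quat set"
    by (rule open_quat_def)
qed (simp_all add: quat_ops algebra_simps)

end

definition qcnj :: "quat \<Rightarrow> quat" where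
  "qcnj q = Quat (qRe q) (- qI q) (- qJ q) (- qK q)"

lemma inverse_unit_quat: "norm q = 1 \<Longrightarrow> inverse q = qcnj q"
  by (simp add: inverse_quat_def qcnj_def)


section \<open>Row left rank over a division ring\<close>

text \<open>A set \<open>S\<close> of row indices, rather than a set of row vectors, is tested for independence, so
  two equal rows with distinct indices are dependent. The scalars multiply from the left.\<close>

definition left_independent_rows ::
    "'j set \<Rightarrow> ('i \<Rightarrow> 'j \<Rightarrow> 'q::division_ring) \<Rightarrow> 'i set \<Rightarrow> bool" where
  "left_independent_rows J M S \<longleftrightarrow>
     (\<forall>c. (\<forall>j\<in>J. (\<Sum>i\<in>S. c i * M i j) = 0) \<longrightarrow> (\<forall>i\<in>S. c i = 0))"

text \<open>\<open>M\<close> is the matrix with rows indexed by the finite set \<open>I\<close> and columns by \<open>J\<close>.\<close>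

definition row_left_rank :: "'i set \<Rightarrow> 'j set \<Rightarrow> ('i \<Rightarrow> 'j \<Rightarrow> 'q::division_ring) \<Rightarrow> nat" where
  "row_left_rank I J M = Max (card ` {S. S \<subseteq> I \<and> left_independent_rows J M S})"


section \<open>Simple graphs\<close>

text \<open>A finite simple graph is a \<^locale>\<open>pair_graph\<close>: a finite loop-free symmetric digraph whose
  arcs are ordered pairs, each edge \<open>uv\<close> being represented by both \<open>(u, v)\<close> and \<open>(v, u)\<close>.
  Hence the degree of a vertex is its out-degree, and the connected components are the strongly
  connected components.\<close>

definition edges_of_arcs :: "('a \<times> 'a) set \<Rightarrow> 'a set set" where
  "edges_of_arcs A = (\<lambda>(u, v). {u, v}) ` A"

abbreviation graph_components :: "'a pair_pre_digraph \<Rightarrow> 'a set set" where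
  "graph_components G \<equiv> pre_digraph.sccs_verts (with_proj G)"

definition num_pendant :: "'a pair_pre_digraph \<Rightarrow> nat" where
  "num_pendant G = card {v \<in> pverts G. out_degree (with_proj G) v = 1}"

definition cyclomatic :: "'a pair_pre_digraph \<Rightarrow> int" where
  "cyclomatic G =
     int (card (edges_of_arcs (parcs G))) - int (card (pverts G)) + int (card (graph_components G))"

text \<open>A cycle is represented by its set of (undirected) edges, so that starting point and direction
  of traversal do not matter. The length bound removes the closed walks \<open>u, v, u\<close>, which are
  cycles of the symmetric digraph but not of the graph.\<close>

definition cycles :: "'a pair_pre_digraph \<Rightarrow> 'a set set set" where
  "cycles G = {edges_of_arcs (set p) | p. pre_digraph.cycle (with_proj G) p \<and> 3 \<le> length p}"

definition cycle_disjoint :: "'a pair_pre_digraph \<Rightarrow> bool" where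
  "cycle_disjoint G \<longleftrightarrow> (\<forall>C \<in> cycles G. \<forall>D \<in> cycles G. C \<noteq> D \<longrightarrow> \<Union>C \<inter> \<Union>D = {})"


section \<open>Unit quaternion gain graphs\<close>

text \<open>Values of \<open>\<phi>\<close> on non-adjacent pairs are irrelevant.\<close>

locale unit_quat_gain_graph = pair_graph G
  for G :: "'a pair_pre_digraph" +
  fixes \<phi> :: "'a \<Rightarrow> 'a \<Rightarrow> quat"
  assumes gain_unit: "(u, v) \<in> parcs G \<Longrightarrow> norm (\<phi> u v) = 1"
    and gain_inverse: "(u, v) \<in> parcs G \<Longrightarrow> \<phi> u v = inverse (\<phi> v u)"
begin

lemma gain_cnj:
  assumes "(u, v) \<in> parcs G"
  shows "\<phi> u v = qcnj (\<phi> v u)"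
proof -
  have "(v, u) \<in> parcs G" using assms by (metis arcs_symmetric)
  then show ?thesis using assms gain_inverse gain_unit inverse_unit_quat by metis
qed

end

definition gain_adjacency :: "'a pair_pre_digraph \<Rightarrow> ('a \<Rightarrow> 'a \<Rightarrow> quat) \<Rightarrow> 'a \<Rightarrow> 'a \<Rightarrow> quat" where
  "gain_adjacency G \<phi> u v = (if (u, v) \<in> parcs G then \<phi> u v else 0)"

definition gain_rank :: "'a pair_pre_digraph \<Rightarrow> ('a \<Rightarrow> 'a \<Rightarrow> quat) \<Rightarrow> nat" where
  "gain_rank G \<phi> = row_left_rank (pverts G) (pverts G) (gain_adjacency G \<phi>)"

end

theory Submission
  imports Defs
begin

text \<open>Order the vertices and put \<open>v\<close> into \<open>I\<close> whenever it has a neighbour outside the closed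
  neighbourhood of its predecessors: the column of that neighbour shows that the rows in \<open>I\<close> are
  independent. If \<open>v\<close> itself lies in that closed neighbourhood and has an earlier neighbour, then
  adding \<open>v\<close> enlarges the closed neighbourhood by at most \<open>deg v - 1\<close> vertices, so the difference
  between its size and \<open>|I|\<close> grows by at most the truncated difference \<open>deg v - 2\<close>. The first
  vertex of each component costs 2 more, hence without isolated vertices
  \<open>n \<le> r + \<Sum>v. (deg v - 2) + 2\<omega> = r + 2c + p\<close>. One unit is saved by starting at a pendant
  vertex, or by running along a cycle up to a vertex of degree at least 3, which then has two
  earlier neighbours.\<close>

section \<open>Independent rows and periodic sequences\<close>

lemma left_independent_rows_insert:
  assumes "left_independent_rows J M I" "finite I" "v \<notin> I"
    and "w \<in> J" "M v w \<noteq> 0" "\<And>i. i \<in> I \<Longrightarrow> M i w = 0"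
  shows "left_independent_rows J M (insert v I)"
  unfolding left_independent_rows_def
proof (intro allI impI)
  fix c assume c: "\<forall>j\<in>J. (\<Sum>i\<in>insert v I. c i * M i j) = 0"
  \<comment> \<open>Among the rows in \<open>insert v I\<close> only \<open>v\<close> has a nonzero
    entry in column \<open>w\<close>, so this column isolates \<open>c v\<close>.\<close>
  have "(\<Sum>i\<in>insert v I. c i * M i w) = c v * M v w"
    using assms by simp
  moreover have "(\<Sum>i\<in>insert v I. c i * M i w) = 0"
    using c \<open>w \<in> J\<close> by blast
  ultimately have "c v = 0" using \<open>M v w \<noteq> 0\<close> by simp
  then have "\<forall>j\<in>J. (\<Sum>i\<in>I. c i * M i j) = 0"
    using c assms by simp
  then have "\<forall>i\<in>I. c i = 0"
    using assms(1) unfolding left_independent_rows_def by blast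
  with \<open>c v = 0\<close> show "\<forall>i\<in>insert v I. c i = 0" by simp
qed

lemma card_le_row_left_rank:
  assumes "finite I" "S \<subseteq> I" "left_independent_rows J M S"
  shows "card S \<le> row_left_rank I J M"
  unfolding row_left_rank_def using assms by (intro Max_ge) auto

text \<open>Injectivity on one period reduces equality of values to congruence of the indices modulo
  \<open>k\<close>, and \<open>k\<close> cannot divide \<open>d\<close> when
  \<open>0 < d < k\<close>.\<close>

lemma periodic_neq:
  fixes h :: "nat \<Rightarrow> 'b"
  assumes "inj_on h {..<k}" "\<And>i. h (i mod k) = h i" "0 < d" "d < k"
  shows "h (i + d) \<noteq> h i"
proof
  assume "h (i + d) = h i"
  then have "h ((i + d) mod k) = h (i mod k)" using assms(2) by simp
  then have "(i + d) mod k = i mod k"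
    using assms(1,4) by (auto dest: inj_onD)
  then have "k dvd d" by (metis add_diff_cancel_left' le_add1 mod_eq_dvd_iff_nat)
  with assms(3,4) show False by (auto dest: dvd_imp_le)
qed

section \<open>Neighbourhoods, degrees and edge counts\<close>

definition nbrs :: "'a pair_pre_digraph \<Rightarrow> 'a \<Rightarrow> 'a set" where
  "nbrs G v = {w. (v, w) \<in> parcs G}"

definition closed_nbhd :: "'a pair_pre_digraph \<Rightarrow> 'a set \<Rightarrow> 'a set" where
  "closed_nbhd G S = S \<union> (\<Union>v\<in>S. nbrs G v)"

context pair_graph
begin

lemma nbrs_subset: "nbrs G v \<subseteq> pverts G"
  by (auto simp: nbrs_def dest: in_arcsD2)

lemma finite_nbrs [simp]: "finite (nbrs G v)"
  using finite_subset[OF nbrs_subset] by simp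

lemma nbrs_sym: "w \<in> nbrs G v \<longleftrightarrow> v \<in> nbrs G w"
  by (auto simp: nbrs_def arcs_symmetric)

lemma closed_nbhd_subset: "S \<subseteq> pverts G \<Longrightarrow> closed_nbhd G S \<subseteq> pverts G"
  using nbrs_subset by (auto simp: closed_nbhd_def)

lemma finite_closed_nbhd: "S \<subseteq> pverts G \<Longrightarrow> finite (closed_nbhd G S)"
  using finite_subset[OF closed_nbhd_subset] by simp

lemma out_degree_eq_card_nbrs: "out_degree (with_proj G) v = card (nbrs G v)"
proof -
  have "out_arcs (with_proj G) v = Pair v ` nbrs G v"
    by (auto simp: out_arcs_def nbrs_def)
  then show ?thesis
    by (simp add: out_degree_def card_image inj_on_def)
qed

lemma sum_card_nbrs: "(\<Sum>v\<in>pverts G. card (nbrs G v)) = card (parcs G)"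
proof -
  have "parcs G = Sigma (pverts G) (nbrs G)"
    by (auto simp: nbrs_def dest: in_arcsD1)
  then show ?thesis by simp
qed

text \<open>Each fibre of the map from arcs to edges consists of two opposite arcs, which are
  distinct because there are no loops.\<close>

lemma card_parcs: "card (parcs G) = 2 * card (edges_of_arcs (parcs G))"
proof -
  let ?E = "edges_of_arcs (parcs G)"
  let ?f = "\<lambda>(u, v). {u, v}"
  have "card (parcs G) = (\<Sum>e\<in>?E. card {a \<in> parcs G. ?f a = e})"
    using sum.image_gen[of "parcs G" "\<lambda>_. 1::nat" ?f] by (simp add: edges_of_arcs_def)
  also have "\<dots> = (\<Sum>e\<in>?E. 2)"
  proof (rule sum.cong)
    fix e assume "e \<in> ?E"
    then obtain u v where uv: "(u, v) \<in> parcs G" "e = {u, v}"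
      by (auto simp: edges_of_arcs_def)
    then have "(v, u) \<in> parcs G" "u \<noteq> v"
      using arcs_symmetric no_loops' by auto
    then have "{a \<in> parcs G. ?f a = e} = {(u, v), (v, u)}"
      using uv by (auto simp: doubleton_eq_iff)
    then show "card {a \<in> parcs G. ?f a = e} = 2"
      using \<open>u \<noteq> v\<close> by simp
  qed simp
  finally show ?thesis by simp
qed

text \<open>No degree is 0, so the truncated \<open>d - 2\<close> differs from the integer one only
  at \<open>d = 1\<close>, where it is larger by one. These corrections add up to the number of
  pendant vertices; the degree sum is twice the number of edges.\<close>

lemma sum_excess_degree:
  assumes "\<And>v. v \<in> pverts G \<Longrightarrow> nbrs G v \<noteq> {}"
  shows "int (\<Sum>v\<in>pverts G. card (nbrs G v) - 2) =
    2 * int (card (edges_of_arcs (parcs G))) - 2 * int (card (pverts G)) + int (num_pendant G)"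
proof -
  have "int (card (nbrs G v) - 2) = int (card (nbrs G v)) - 2 + (if card (nbrs G v) = 1 then 1 else 0)"
    if "v \<in> pverts G" for v
  proof -
    have "card (nbrs G v) \<noteq> 0" using assms[OF that] by simp
    then have "card (nbrs G v) = 1 \<or> 2 \<le> card (nbrs G v)" by linarith
    then show ?thesis by (auto simp: of_nat_diff)
  qed
  then have "int (\<Sum>v\<in>pverts G. card (nbrs G v) - 2) =
      (\<Sum>v\<in>pverts G. int (card (nbrs G v)) - 2 + (if card (nbrs G v) = 1 then 1 else 0))"
    by simp
  also have "\<dots> = int (\<Sum>v\<in>pverts G. card (nbrs G v)) - 2 * int (card (pverts G)) + int (num_pendant G)"
    by (simp add: sum.distrib sum_subtractf num_pendant_def out_degree_eq_card_nbrs
        flip: sum.inter_filter)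
  finally show ?thesis
    by (simp only: sum_card_nbrs card_parcs of_nat_mult of_nat_numeral)
qed

section \<open>Connected components\<close>

lemma nbr_in_component:
  assumes "C \<in> graph_components G" "v \<in> C" "w \<in> nbrs G v"
  shows "w \<in> C"
proof -
  \<comment> \<open>Components are strongly connected components, so reachability is required in
    both directions.\<close>
  have "v \<rightarrow>\<^sup>*\<^bsub>with_proj G\<^esub> w" "w \<rightarrow>\<^sup>*\<^bsub>with_proj G\<^esub> v"
    using assms(3) by (auto simp: nbrs_def arcs_symmetric)
  then show ?thesis
    using assms(1,2) unfolding in_sccs_verts_conv_reachable by blast
qed

text \<open>Otherwise membership in \<open>C \<inter> S\<close> would propagate along a path from
  \<open>u\<close> to a vertex of \<open>C\<close> outside \<open>S\<close>.\<close>

lemma component_edge_leaving: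
  assumes C: "C \<in> graph_components G" and "u \<in> C \<inter> S" "\<not> C \<subseteq> S"
  shows "\<exists>v w. v \<in> S \<and> w \<in> C - S \<and> w \<in> nbrs G v"
proof (rule ccontr)
  assume none: "\<not> ?thesis"
  obtain x where x: "x \<in> C" "x \<notin> S" using assms by blast
  have "u \<rightarrow>\<^sup>*\<^bsub>with_proj G\<^esub> x"
    using C assms(2) x unfolding in_sccs_verts_conv_reachable by blast
  then have "x \<in> C \<inter> S"
  proof (induction rule: reachable_induct)
    case base
    show ?case using assms(2) .
  next
    case (step y z)
    have "z \<in> nbrs G y" using step(2) by (simp add: nbrs_def)
    with step.IH none show ?case
      using nbr_in_component[OF C] by blast
  qed
  with x show False by simp
qed

lemma nbrs_nonempty:
  assumes "\<forall>C \<in> graph_components G. 2 \<le> card C" "v \<in> pverts G"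
  shows "nbrs G v \<noteq> {}"
proof -
  obtain C where C: "C \<in> graph_components G" "v \<in> C"
    using scc_of_in_sccs_verts[of v] in_scc_of_self[of v] assms(2) by auto
  have "\<not> C \<subseteq> {v}"
    using assms(1) C card_mono[of "{v}" C] by fastforce
  then show ?thesis
    using component_edge_leaving[OF C(1), of v "{v}"] C(2) by auto
qed

section \<open>Cycles as periodic vertex sequences\<close>

text \<open>Indexing the vertices by all natural numbers lets a cycle be followed from any of its
  vertices without treating the return to the start separately.\<close>

lemma cycle_periodic:
  assumes "C \<in> cycles G"
  obtains h :: "nat \<Rightarrow> 'a" and k where "3 \<le> k" "inj_on h {..<k}" "\<And>i. h (i mod k) = h i"
    "\<And>i. h (Suc i) \<in> nbrs G (h i)" "C = range (\<lambda>i. {h i, h (Suc i)})"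
proof -
  obtain p where p: "cycle p" "3 \<le> length p" and C: "C = edges_of_arcs (set p)"
    using assms unfolding cycles_def by blast
  obtain u where u: "awalk u p u" "distinct (tl (awalk_verts u p))"
    using p unfolding cycle_def by blast
  define k where "k = length p"
  \<comment> \<open>Heads are taken because \<open>cycle\<close> demands distinctness of
    \<open>tl (awalk_verts u p)\<close>, which is the list of heads.\<close>
  define h where "h i = snd (p ! (i mod k))" for i
  have k: "3 \<le> k" using p by (simp add: k_def)
  have cas: "cas u p u" and arcs: "set p \<subseteq> parcs G"
    using u by (auto simp: awalk_def)
  have "awalk_verts u p = u # map snd p"
    using awalk_verts_conv'[OF cas] cas k by (cases p) (auto simp: k_def)
  then have "distinct (map snd p)" using u by simp
  then have inj: "inj_on h {..<k}"
    by (auto simp: inj_on_def h_def k_def distinct_conv_nth)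
  have consec: "fst (q ! Suc i) = snd (q ! i)"
    if "cas a q b" "Suc i < length q" for a b i and q :: "('a \<times> 'a) list"
    using that
  proof (induction q arbitrary: a i)
    case (Cons e q)
    then show ?case by (cases i; cases q) auto
  qed simp
  have "fst (p ! 0) = u" "snd (p ! (k - 1)) = u"
  proof -
    show "fst (p ! 0) = u" using cas k by (cases p) (auto simp: k_def)
    have "snd (last q) = b" if "cas a q b" "q \<noteq> []" for a b and q :: "('a \<times> 'a) list"
      using that by (induction q arbitrary: a) auto
    from this[OF cas] show "snd (p ! (k - 1)) = u"
      using k by (cases "p = []") (auto simp: k_def last_conv_nth)
  qed
  note ends = this
  \<comment> \<open>Since \<open>h\<close> lists heads, the arc leaving \<open>h i\<close> is the
    next one in \<open>p\<close>. In the first case it is the first arc again, and the two ends of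
    the closed walk meet at \<open>u\<close>.\<close>
  have arc: "p ! (Suc i mod k) = (h i, h (Suc i))" for i
  proof (cases "Suc (i mod k) = k")
    case True
    then have "i mod k = k - 1" by simp
    with ends True show ?thesis by (simp add: h_def mod_Suc prod_eq_iff)
  next
    case False
    moreover have "i mod k < k" using k by simp
    ultimately have "Suc (i mod k) < length p" by (simp add: k_def)
    from consec[OF cas this] False show ?thesis
      by (simp add: h_def mod_Suc prod_eq_iff)
  qed
  have "Suc i mod k < length p" for i
    unfolding k_def[symmetric] using k by simp
  then have "p ! (Suc i mod k) \<in> set p" for i
    by (rule nth_mem)
  then have in_p: "(h i, h (Suc i)) \<in> set p" for i
    by (simp only: arc)
  have "\<exists>i. e = (h i, h (Suc i))" if e: "e \<in> set p" for e
  proof -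
    obtain j where j: "j < k" "e = p ! j"
      using e by (auto simp: in_set_conv_nth k_def)
    \<comment> \<open>Adding \<open>k\<close> gives a predecessor of \<open>j\<close> modulo
      \<open>k\<close> even for \<open>j = 0\<close>.\<close>
    then have "Suc (j + k - 1) mod k = j" by simp
    with j arc[of "j + k - 1"] show ?thesis by metis
  qed
  then have "C = range (\<lambda>i. {h i, h (Suc i)})"
    using in_p unfolding C edges_of_arcs_def by force
  moreover have "h (Suc i) \<in> nbrs G (h i)" for i
    using in_p arcs by (auto simp: nbrs_def)
  moreover have "h (i mod k) = h i" for i
    by (simp add: h_def)
  ultimately show ?thesis using that k inj by blast
qed

text \<open>A vertex of \<open>C\<close> already has two neighbours along \<open>C\<close>, so by
  the degree bound every edge at it lies in \<open>C\<close>. Following \<open>D\<close> from the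
  common vertex \<open>x\<close> therefore never leaves \<open>C\<close>.\<close>

lemma cycle_subset_of_degree_2:
  assumes C: "C \<in> cycles G" and D: "D \<in> cycles G" and meet: "x \<in> \<Union>C \<inter> \<Union>D"
    and deg: "\<And>v. v \<in> \<Union>C \<Longrightarrow> card (nbrs G v) \<le> 2"
  shows "D \<subseteq> C"
proof -
  obtain h k where h: "3 \<le> k" "inj_on h {..<k}" "\<And>i. h (i mod k) = h i"
    "\<And>i. h (Suc i) \<in> nbrs G (h i)" "C = range (\<lambda>i. {h i, h (Suc i)})"
    by (rule cycle_periodic[OF C], rule that)
  obtain g l where g: "3 \<le> l" "inj_on g {..<l}" "\<And>i. g (i mod l) = g i"
    "\<And>i. g (Suc i) \<in> nbrs G (g i)" "D = range (\<lambda>i. {g i, g (Suc i)})"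
    by (rule cycle_periodic[OF D], rule that)
  have UC: "\<Union>C = range h" using h(5) by auto
  have step: "w \<in> \<Union>C \<and> {v, w} \<in> C" if vw: "v \<in> \<Union>C" "w \<in> nbrs G v" for v w
  proof -
    obtain i0 where "v = h i0" using vw(1) UC by auto
    \<comment> \<open>The predecessor of \<open>i0\<close> along the cycle, shifted by one period so
      that the subtraction does not truncate.\<close>
    define i where "i = i0 + k - 1"
    have v: "v = h (Suc i)"
      using h(1) h(3)[of "i0 + k"] h(3)[of i0] \<open>v = h i0\<close> by (simp add: i_def)
    have "h (i + 2) \<noteq> h i"
      by (rule periodic_neq[OF h(2,3)]) (use h(1) in auto)
    then have card2: "card {h i, h (Suc (Suc i))} = 2" by simp
    have sub: "{h i, h (Suc (Suc i))} \<subseteq> nbrs G v"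
      using h(4)[of "Suc i"] h(4)[of i] nbrs_sym v by auto
    have "{h i, h (Suc (Suc i))} = nbrs G v"
      using card_seteq[OF finite_nbrs sub] deg[OF vw(1)] card2 by simp
    then have "w = h i \<or> w = h (Suc (Suc i))" using vw(2) by blast
    then show ?thesis using v h(5) UC by (auto simp: insert_commute)
  qed
  obtain j where j: "g j \<in> \<Union>C" using meet g(5) by auto
  have walk: "g (j + m) \<in> \<Union>C" for m
    by (induction m) (use j step g(4) in auto)
  \<comment> \<open>The walk only covers indices from \<open>j\<close> on; the shift by
    \<open>l * j\<close>, a multiple of the period, moves \<open>t\<close> into that range.\<close>
  have "{g t, g (Suc t)} \<in> C" for t
  proof -
    have "j + (t + l * j - j) = t + l * j"
      using g(1) by (simp add: trans_le_add2)
    then have "g (t + l * j) \<in> \<Union>C" using walk by metis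
    then have "{g (t + l * j), g (Suc (t + l * j))} \<in> C"
      using step g(4) by blast
    moreover have "g (t + l * j) = g t" "g (Suc (t + l * j)) = g (Suc t)"
      using g(3)[of "t + l * j"] g(3)[of t] g(3)[of "Suc t + l * j"] g(3)[of "Suc t"] by simp_all
    ultimately show ?thesis by simp
  qed
  then show ?thesis unfolding g(5) by blast
qed

text \<open>If all degrees on \<open>C\<close> were at most 2, then \<open>D \<subseteq> C\<close>.
  Hence the bound also holds on \<open>D\<close>, and exchanging the roles gives
  \<open>C = D\<close>.\<close>

lemma meeting_cycles_branch_vertex:
  assumes C: "C \<in> cycles G" and D: "D \<in> cycles G" and "C \<noteq> D" "\<Union>C \<inter> \<Union>D \<noteq> {}"
  shows "\<exists>v\<in>\<Union>C. 3 \<le> card (nbrs G v)"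
proof (rule ccontr)
  assume "\<not> ?thesis"
  then have deg: "card (nbrs G v) \<le> 2" if "v \<in> \<Union>C" for v
    using that by force
  obtain x where x: "x \<in> \<Union>C \<inter> \<Union>D" using assms(4) by blast
  have "D \<subseteq> C" by (rule cycle_subset_of_degree_2[OF C D x deg])
  moreover have "C \<subseteq> D"
    by (rule cycle_subset_of_degree_2[OF D C, of x]) (use x deg \<open>D \<subseteq> C\<close> in blast)+
  ultimately show False using assms(3) by blast
qed

end

section \<open>The deficit and the cost of adding a vertex\<close>

context unit_quat_gain_graph
begin

text \<open>The invariant for the set \<open>S\<close> of vertices processed so far:
  \<open>m\<close> is the allowance beyond the truncated degree excesses. With \<open>I\<close>
  quantified away, only \<open>S\<close> and \<open>m\<close> have to be tracked.\<close>

definition deficit_le :: "'a set \<Rightarrow> nat \<Rightarrow> bool" where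
  "deficit_le S m \<longleftrightarrow> S \<subseteq> pverts G \<and>
    (\<exists>I\<subseteq>S. left_independent_rows (pverts G) (gain_adjacency G \<phi>) I \<and>
      card (closed_nbhd G S) \<le> card I + (\<Sum>v\<in>S. card (nbrs G v) - 2) + m)"

lemma deficit_le_empty: "deficit_le {} m"
  by (auto simp: deficit_le_def closed_nbhd_def left_independent_rows_def)

lemma deficit_le_mono: "deficit_le S m \<Longrightarrow> m \<le> m' \<Longrightarrow> deficit_le S m'"
  unfolding deficit_le_def by (meson add_left_mono order_trans)

text \<open>In the hypothesis \<open>cost\<close>, the truncated \<open>- 1\<close> accounts for the row of \<open>v\<close>, which is added to the
  independent set exactly when \<open>v\<close> has a neighbour outside the closed neighbourhood of \<open>S\<close>.\<close>

lemma deficit_le_insert: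
  assumes S: "deficit_le S m" and v: "v \<in> pverts G" "v \<notin> S"
    and cost: "(if v \<in> closed_nbhd G S then 0 else 1) + (card (nbrs G v - closed_nbhd G S) - 1) + m
      \<le> (card (nbrs G v) - 2) + m'"
  shows "deficit_le (insert v S) m'"
proof -
  let ?N = "closed_nbhd G S" and ?M = "gain_adjacency G \<phi>"
  obtain I where I: "I \<subseteq> S" "left_independent_rows (pverts G) ?M I"
    "card ?N \<le> card I + (\<Sum>v\<in>S. card (nbrs G v) - 2) + m" and SV: "S \<subseteq> pverts G"
    using S unfolding deficit_le_def by blast
  have fin: "finite S" "finite I" "finite ?N"
    using SV I(1) finite_closed_nbhd[OF SV] finite_subset[of S] finite_subset[of I] pair_finite_verts
    by (blast intro: finite_subset)+
  have N: "closed_nbhd G (insert v S) = (?N \<union> ({v} - ?N)) \<union> (nbrs G v - ?N)"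
    by (auto simp: closed_nbhd_def)
  have "card (closed_nbhd G (insert v S)) \<le> card ?N + card ({v} - ?N) + card (nbrs G v - ?N)"
    unfolding N by (intro order_trans[OF card_Un_le] add_mono card_Un_le order_refl)
  moreover have "card ({v} - ?N) = (if v \<in> ?N then 0 else 1)"
    by (simp add: insert_Diff_if)
  ultimately have card: "card (closed_nbhd G (insert v S))
      \<le> card ?N + (if v \<in> ?N then 0 else 1) + card (nbrs G v - ?N)"
    by simp
  have "\<exists>I'\<subseteq>insert v S. left_independent_rows (pverts G) ?M I' \<and>
      card I + card (nbrs G v - ?N) \<le> card I' + (card (nbrs G v - ?N) - 1)"
  proof (cases "nbrs G v - ?N = {}")
    case True
    then show ?thesis using I(1,2) by (intro exI[of _ I]) (auto simp: True)
  next
    case False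
    then obtain w where w: "w \<in> nbrs G v" "w \<notin> ?N" by blast
    have "v \<notin> I" using I(1) v by blast
    have "left_independent_rows (pverts G) ?M (insert v I)"
    proof (rule left_independent_rows_insert[OF I(2) fin(2) \<open>v \<notin> I\<close>, of w])
      show "w \<in> pverts G" using w(1) nbrs_subset by blast
      have "(v, w) \<in> parcs G" using w(1) by (simp add: nbrs_def)
      then show "?M v w \<noteq> 0"
        using gain_unit[of v w] by (auto simp: gain_adjacency_def)
      show "?M i w = 0" if "i \<in> I" for i
        using w(2) that I(1) by (auto simp: gain_adjacency_def closed_nbhd_def nbrs_def)
    qed
    moreover have "card (nbrs G v - ?N) \<noteq> 0" using False by simp
    ultimately show ?thesis
      using I(1) fin(2) \<open>v \<notin> I\<close> by (intro exI[of _ "insert v I"]) auto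
  qed
  then obtain I' where I': "I' \<subseteq> insert v S" "left_independent_rows (pverts G) ?M I'"
    "card I + card (nbrs G v - ?N) \<le> card I' + (card (nbrs G v - ?N) - 1)"
    by blast
  have "(\<Sum>v\<in>insert v S. card (nbrs G v) - 2) = (card (nbrs G v) - 2) + (\<Sum>v\<in>S. card (nbrs G v) - 2)"
    using fin v by simp
  then have "card (closed_nbhd G (insert v S)) \<le> card I' + (\<Sum>v\<in>insert v S. card (nbrs G v) - 2) + m'"
    using card I(3) I'(3) cost by linarith
  then show ?thesis
    using I'(1,2) SV v unfolding deficit_le_def by blast
qed

text \<open>For degree \<open>d \<ge> 2\<close> the vertex itself and its new neighbours, less one
  for its row, number at most \<open>d\<close>, against \<open>d - 2\<close> in the degree sum. For
  smaller \<open>d\<close> the cost is at most 1.\<close>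

lemma deficit_le_insert_start:
  assumes "deficit_le S m" "v \<in> pverts G" "v \<notin> S"
  shows "deficit_le (insert v S) (m + 2)"
proof (rule deficit_le_insert[OF assms])
  have "card (nbrs G v - closed_nbhd G S) \<le> card (nbrs G v)"
    by (rule card_mono) auto
  then show "(if v \<in> closed_nbhd G S then 0 else 1) + (card (nbrs G v - closed_nbhd G S) - 1) + m
      \<le> (card (nbrs G v) - 2) + (m + 2)"
    by auto
qed

text \<open>The row of \<open>v\<close> pays for its only neighbour, so just \<open>v\<close> itself
  is charged.\<close>

lemma deficit_le_insert_pendant:
  assumes "deficit_le S m" "v \<in> pverts G" "v \<notin> S" "card (nbrs G v) = 1"
  shows "deficit_le (insert v S) (m + 1)"
proof (rule deficit_le_insert[OF assms(1-3)])
  have "card (nbrs G v - closed_nbhd G S) \<le> card (nbrs G v)"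
    by (rule card_mono) auto
  then show "(if v \<in> closed_nbhd G S then 0 else 1) + (card (nbrs G v - closed_nbhd G S) - 1) + m
      \<le> (card (nbrs G v) - 2) + (m + 1)"
    using assms(4) by auto
qed

lemma card_new_nbrs:
  assumes "T \<subseteq> S \<inter> nbrs G v"
  shows "card (nbrs G v - closed_nbhd G S) \<le> card (nbrs G v) - card T"
proof -
  have "card (nbrs G v - closed_nbhd G S) \<le> card (nbrs G v - T)"
    by (rule card_mono) (use assms in \<open>auto simp: closed_nbhd_def\<close>)
  also have "\<dots> = card (nbrs G v) - card T"
    by (rule card_Diff_subset) (use assms finite_subset[of T "nbrs G v"] in auto)
  finally show ?thesis .
qed

text \<open>Neither \<open>v\<close> nor \<open>u\<close> is new, so at most \<open>d - 1\<close>
  vertices are new; after the row of \<open>v\<close> is counted, \<open>d - 2\<close> remain, as in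
  the degree sum.\<close>

lemma deficit_le_insert_nbr:
  assumes "deficit_le S m" "v \<notin> S" "u \<in> S" "v \<in> nbrs G u"
  shows "deficit_le (insert v S) m"
proof (rule deficit_le_insert[OF assms(1) _ assms(2)])
  show "v \<in> pverts G" using assms(4) nbrs_subset by blast
  have "v \<in> closed_nbhd G S" using assms by (auto simp: closed_nbhd_def)
  moreover have "card (nbrs G v - closed_nbhd G S) \<le> card (nbrs G v) - 1"
    using card_new_nbrs[of "{u}" S v] assms nbrs_sym by auto
  ultimately show "(if v \<in> closed_nbhd G S then 0 else 1)
      + (card (nbrs G v - closed_nbhd G S) - 1) + m \<le> (card (nbrs G v) - 2) + m"
    by auto
qed

text \<open>Now at most \<open>d - 2\<close> neighbours are new, and one less after counting the
  row. The saving is genuine because \<open>d \<ge> 3\<close> keeps \<open>d - 3\<close> from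
  truncating.\<close>

lemma deficit_le_insert_two_nbrs:
  assumes "deficit_le S (m + 1)" "v \<notin> S" "u \<in> S" "v \<in> nbrs G u" "w \<in> S" "v \<in> nbrs G w" "u \<noteq> w"
    and "3 \<le> card (nbrs G v)"
  shows "deficit_le (insert v S) m"
proof (rule deficit_le_insert[OF assms(1) _ assms(2)])
  show "v \<in> pverts G" using assms(4) nbrs_subset by blast
  have "v \<in> closed_nbhd G S" using assms by (auto simp: closed_nbhd_def)
  moreover have "card (nbrs G v - closed_nbhd G S) \<le> card (nbrs G v) - 2"
    using card_new_nbrs[of "{u, w}" S v] assms nbrs_sym by auto
  ultimately show "(if v \<in> closed_nbhd G S then 0 else 1)
      + (card (nbrs G v - closed_nbhd G S) - 1) + (m + 1) \<le> (card (nbrs G v) - 2) + m"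
    using assms(8) by auto
qed

section \<open>Exhausting the components\<close>

text \<open>While \<open>C\<close> is not covered, some edge leads from \<open>S\<close> to a vertex
  of \<open>C - S\<close>, which can be added at no cost.\<close>

lemma deficit_le_Un_component:
  assumes C: "C \<in> graph_components G" and "deficit_le S m" "C \<inter> S \<noteq> {}"
  shows "deficit_le (S \<union> C) m"
  using assms(2,3)
proof (induction "card (C - S)" arbitrary: S rule: less_induct)
  case less
  show ?case
  proof (cases "C \<subseteq> S")
    case True
    then show ?thesis using less.prems by (simp add: Un_absorb2)
  next
    case False
    then obtain v w where vw: "v \<in> S" "w \<in> C - S" "w \<in> nbrs G v"
      using component_edge_leaving[OF C] less.prems by blast
    have "finite C"
      using sccs_verts_subsets[OF C] by (intro finite_subset[OF _ pair_finite_verts]) simp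
    then have "card (C - insert w S) < card (C - S)"
      using vw by (intro psubset_card_mono) auto
    moreover have "deficit_le (insert w S) m"
      using deficit_le_insert_nbr less.prems vw by blast
    ultimately have "deficit_le (insert w S \<union> C) m"
      using less.hyps less.prems by blast
    then show ?thesis using vw by (simp add: insert_absorb)
  qed
qed

text \<open>Each component pays 2 for a starting vertex and nothing for the rest. If that vertex is
  already covered, the 2 units are left unspent.\<close>

lemma deficit_le_add_components:
  assumes "finite F" "F \<subseteq> graph_components G" "deficit_le S m"
  shows "deficit_le (S \<union> \<Union>F) (m + 2 * card F)"
  using assms
proof (induction F rule: finite_induct)
  case (insert C F)
  have C: "C \<in> graph_components G" using insert.prems by simp
  then obtain v where v: "v \<in> C" "v \<in> pverts G"
    using sccs_verts_subsets[OF C] unfolding in_sccs_verts_conv_reachable by auto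
  let ?S = "S \<union> \<Union>F"
  have IH: "deficit_le ?S (m + 2 * card F)"
    using insert by simp
  have "\<exists>T. ?S \<subseteq> T \<and> T \<subseteq> ?S \<union> C \<and> v \<in> T \<and> deficit_le T (m + 2 * card F + 2)"
  proof (cases "v \<in> ?S")
    case True
    moreover have "deficit_le ?S (m + 2 * card F + 2)"
      using IH by (rule deficit_le_mono) simp
    ultimately show ?thesis by blast
  next
    case False
    then show ?thesis
      using deficit_le_insert_start[OF IH v(2)] v(1) by (intro exI[of _ "insert v ?S"]) auto
  qed
  then obtain T where T: "?S \<subseteq> T" "T \<subseteq> ?S \<union> C" "v \<in> T" "deficit_le T (m + 2 * card F + 2)"
    by blast
  have "deficit_le (T \<union> C) (m + 2 * card F + 2)"
    using deficit_le_Un_component[OF C T(4)] T(3) v(1) by blast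
  moreover have "T \<union> C = S \<union> \<Union>(insert C F)" using T by auto
  ultimately show ?case using insert by simp
qed simp

lemma Union_components: "\<Union>(graph_components G) = pverts G"
proof (intro equalityI subsetI)
  fix v assume "v \<in> pverts G"
  then show "v \<in> \<Union>(graph_components G)"
    using scc_of_in_sccs_verts[of v] in_scc_of_self[of v] by auto
qed (use sccs_verts_subsets in auto)

lemma deficit_le_pverts: "deficit_le (pverts G) (2 * card (graph_components G))"
  using deficit_le_add_components[OF finite_sccs_verts order_refl deficit_le_empty[of 0]]
  by (simp add: Union_components)

text \<open>The set \<open>S\<close> replaces the starting vertex of one component it meets, for 1
  instead of 2; every other component costs at most 2.\<close>

lemma deficit_le_pverts_start:
  assumes S: "deficit_le S 1" "S \<noteq> {}"
  shows "deficit_le (pverts G) (2 * card (graph_components G) - 1)"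
proof -
  let ?F = "graph_components G"
  obtain v where v: "v \<in> S" using S by blast
  then have "v \<in> pverts G" using S(1) unfolding deficit_le_def by blast
  then obtain C where C: "C \<in> ?F" "v \<in> C"
    using Union_components by blast
  have "deficit_le (S \<union> C) 1"
    using deficit_le_Un_component[OF C(1) S(1)] C v by blast
  then have "deficit_le ((S \<union> C) \<union> \<Union>(?F - {C})) (1 + 2 * card (?F - {C}))"
    using finite_sccs_verts by (intro deficit_le_add_components) auto
  moreover have "(S \<union> C) \<union> \<Union>(?F - {C}) = pverts G"
    using C Union_components S(1) unfolding deficit_le_def by blast
  moreover have "card ?F = Suc (card (?F - {C}))"
    using C finite_sccs_verts by (metis card.remove)
  ultimately show ?thesis by simp
qed

section \<open>Saving one unit on a cycle\<close>

text \<open>The path round the cycle from the successor of \<open>v\<close> to its predecessor costs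
  2. Adding \<open>v\<close> last, next to both ends of the path, wins one unit back.\<close>

lemma deficit_le_cycle:
  assumes C: "C \<in> cycles G" and v: "v \<in> \<Union>C" "3 \<le> card (nbrs G v)"
  shows "\<exists>S. S \<noteq> {} \<and> deficit_le S 1"
proof -
  obtain h k where h: "3 \<le> k" "inj_on h {..<k}" "\<And>i. h (i mod k) = h i"
    "\<And>i. h (Suc i) \<in> nbrs G (h i)" "C = range (\<lambda>i. {h i, h (Suc i)})"
    by (rule cycle_periodic[OF C], rule that)
  obtain i where i: "v = h i" using v(1) h(5) by auto
  have neq: "h (i + a) \<noteq> h (i + b)" if "a < b" "b < a + k" for a b
  proof -
    have eq: "i + a + (b - a) = i + b" using that by simp
    have "h (i + a + (b - a)) \<noteq> h (i + a)"
      by (rule periodic_neq[OF h(2,3)]) (use that in auto)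
    then show ?thesis unfolding eq by (rule not_sym)
  qed
  \<comment> \<open>The \<open>m\<close> vertices after \<open>v\<close>: the first costs 2, and
    each later one is a new neighbour of the one before, distinctness coming from
    \<open>m < k\<close>.\<close>
  have path: "deficit_le (h ` {i + 1..i + m}) 2" if "1 \<le> m" "m < k" for m
    using that
  proof (induction m rule: dec_induct)
    case base
    have "h (i + 1) \<in> pverts G" using h(4)[of i] nbrs_subset by auto
    then show ?case
      using deficit_le_insert_start[OF deficit_le_empty[of 0]] by (simp add: numeral_2_eq_2)
  next
    case (step m)
    have "h (i + Suc m) \<notin> h ` {i + 1..i + m}"
    proof
      assume "h (i + Suc m) \<in> h ` {i + 1..i + m}"
      then obtain t where t: "i + 1 \<le> t" "t \<le> i + m" "h (i + Suc m) = h t" by auto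
      then have "t - i < Suc m" "Suc m < t - i + k" "i + (t - i) = t" using step by auto
      then show False using neq[of "t - i" "Suc m"] t(3) by simp
    qed
    moreover have "h (i + m) \<in> h ` {i + 1..i + m}" using step by simp
    moreover have "h (i + Suc m) \<in> nbrs G (h (i + m))" using h(4) by simp
    ultimately have "deficit_le (insert (h (i + Suc m)) (h ` {i + 1..i + m})) 2"
      using step by (intro deficit_le_insert_nbr) simp_all
    moreover have "{i + 1..i + Suc m} = insert (i + Suc m) {i + 1..i + m}" by auto
    ultimately show ?case by simp
  qed
  let ?S = "h ` {i + 1..i + (k - 1)}"
  have S: "deficit_le ?S (1 + 1)" using path[of "k - 1"] h(1) by (simp add: numeral_2_eq_2)
  have "h (i + k) = v" using h(3)[of "i + k"] h(3)[of i] i by simp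
  have notin: "v \<notin> ?S"
  proof
    assume "v \<in> ?S"
    then obtain t where t: "i + 1 \<le> t" "t \<le> i + (k - 1)" "h i = h t" using i by auto
    then have "0 < t - i" "t - i < 0 + k" using h(1) by auto
    then show False using neq[of 0 "t - i"] t by simp
  qed
  have "deficit_le (insert v ?S) 1"
  proof (rule deficit_le_insert_two_nbrs[OF S notin])
    show "h (i + 1) \<in> ?S" "h (i + (k - 1)) \<in> ?S" using h(1) by auto
    show "v \<in> nbrs G (h (i + 1))" using h(4)[of i] nbrs_sym i by auto
    show "v \<in> nbrs G (h (i + (k - 1)))"
      using h(4)[of "i + (k - 1)"] \<open>h (i + k) = v\<close> h(1) by simp
    \<comment> \<open>The two ends of the path differ because \<open>k \<ge> 3\<close>.\<close>
    show "h (i + 1) \<noteq> h (i + (k - 1))" using h(1) by (intro neq) auto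
  qed (rule v(2))
  then show ?thesis by (intro exI[of _ "insert v ?S"] conjI insert_not_empty)
qed

section \<open>From the deficit to the rank bounds\<close>

text \<open>The closed neighbourhood of all vertices has size \<open>n\<close>, and the degree sum
  contributes \<open>2|E| - 2n + p\<close>, where \<open>|E| - n\<close> is the cyclomatic number
  minus the number of components.\<close>

lemma deficit_le_imp_rank:
  assumes "deficit_le (pverts G) m" "\<forall>C \<in> graph_components G. 2 \<le> card C"
  shows "int (card (pverts G)) \<le> int (gain_rank G \<phi>)
    + 2 * (cyclomatic G - int (card (graph_components G))) + int (num_pendant G) + int m"
proof -
  obtain I where I: "I \<subseteq> pverts G" "left_independent_rows (pverts G) (gain_adjacency G \<phi>) I"
    "card (closed_nbhd G (pverts G)) \<le> card I + (\<Sum>v\<in>pverts G. card (nbrs G v) - 2) + m"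
    using assms(1) unfolding deficit_le_def by blast
  have "card I \<le> gain_rank G \<phi>"
    unfolding gain_rank_def using I by (intro card_le_row_left_rank) auto
  moreover have "closed_nbhd G (pverts G) = pverts G"
    using closed_nbhd_subset by (auto simp: closed_nbhd_def)
  ultimately have "card (pverts G) \<le> gain_rank G \<phi> + (\<Sum>v\<in>pverts G. card (nbrs G v) - 2) + m"
    using I(3) by simp
  then have "int (card (pverts G)) \<le>
      int (gain_rank G \<phi>) + int (\<Sum>v\<in>pverts G. card (nbrs G v) - 2) + int m"
    by (simp only: of_nat_le_iff flip: of_nat_add)
  also have "int (\<Sum>v\<in>pverts G. card (nbrs G v) - 2) =
      2 * int (card (edges_of_arcs (parcs G))) - 2 * int (card (pverts G)) + int (num_pendant G)"
    by (rule sum_excess_degree) (rule nbrs_nonempty[OF assms(2)])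
  finally show ?thesis by (simp add: cyclomatic_def)
qed

end

theorem theorem1p2:
  fixes G :: "'a pair_pre_digraph" and \<phi> :: "'a \<Rightarrow> 'a \<Rightarrow> quat" and n :: nat
  assumes "unit_quat_gain_graph G \<phi>"
    and "n = card (pverts G)"
    and "\<forall>C \<in> graph_components G. 2 \<le> card C"
  shows "(1 \<le> num_pendant G \<longrightarrow>
            int (gain_rank G \<phi>) \<ge> int n - 2 * cyclomatic G - int (num_pendant G) + 1)
       \<and> (num_pendant G = 0 \<and> cycle_disjoint G \<longrightarrow>
            int (gain_rank G \<phi>) \<ge> int n - 2 * cyclomatic G)
       \<and> (num_pendant G = 0 \<and> (\<exists>C \<in> cycles G. \<exists>D \<in> cycles G. C \<noteq> D \<and> \<Union>C \<inter> \<Union>D \<noteq> {}) \<longrightarrow>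
            int (gain_rank G \<phi>) \<ge> int n - 2 * cyclomatic G + 1)"
proof -
  interpret unit_quat_gain_graph G \<phi> by (rule assms(1))
  note rank = deficit_le_imp_rank[OF _ assms(3)]
  have improved: "int (gain_rank G \<phi>) \<ge> int n - 2 * cyclomatic G - int (num_pendant G) + 1"
    if S: "deficit_le S 1" "S \<noteq> {}" for S
  proof -
    \<comment> \<open>With at least one component, the natural number
      \<open>2 * card (graph_components G) - 1\<close> is not truncated.\<close>
    have "graph_components G \<noteq> {}"
      using S Union_components unfolding deficit_le_def by blast
    then have "1 \<le> card (graph_components G)"
      using finite_sccs_verts by (simp add: Suc_le_eq card_gt_0_iff)
    then show ?thesis
      using rank[OF deficit_le_pverts_start[OF S]] assms(2) by simp
  qed
  have "int (gain_rank G \<phi>) \<ge> int n - 2 * cyclomatic G - int (num_pendant G) + 1"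
    if pendant: "1 \<le> num_pendant G"
  proof -
    obtain v where "v \<in> pverts G" "card (nbrs G v) = 1"
      using card_gt_0_iff[THEN iffD1, of "{v \<in> pverts G. card (nbrs G v) = 1}"] pendant
      by (auto simp: num_pendant_def out_degree_eq_card_nbrs)
    then have "deficit_le {v} 1"
      using deficit_le_insert_pendant[OF deficit_le_empty[of 0]] by simp
    then show ?thesis using improved by blast
  qed
  \<comment> \<open>Two units for every component exactly cancel the component term in the rank
    bound.\<close>
  moreover have "int (gain_rank G \<phi>) \<ge> int n - 2 * cyclomatic G" if "num_pendant G = 0"
    using rank[OF deficit_le_pverts] that assms(2) by simp
  moreover have "int (gain_rank G \<phi>) \<ge> int n - 2 * cyclomatic G + 1"
    if pendant: "num_pendant G = 0"
      and meet: "\<exists>C \<in> cycles G. \<exists>D \<in> cycles G. C \<noteq> D \<and> \<Union>C \<inter> \<Union>D \<noteq> {}"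
  proof -
    obtain C D where CD: "C \<in> cycles G" "D \<in> cycles G" "C \<noteq> D" "\<Union>C \<inter> \<Union>D \<noteq> {}"
      using meet by blast
    obtain v where "v \<in> \<Union>C" "3 \<le> card (nbrs G v)"
      using meeting_cycles_branch_vertex[OF CD] by blast
    then obtain S where "S \<noteq> {}" "deficit_le S 1"
      using deficit_le_cycle[OF CD(1)] by blast
    then show ?thesis using improved[of S] pendant by simp
  qed
  ultimately show ?thesis by blast
qed

end
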